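(* For every integer $n\ge 8$, $$|\mathscr{L}(n;5,3)|=\sum_{i=0}^{n-8}(i+1)\,|\mathscr{B}(n-i;5,3)|,$$ where $\mathscr{L}(n;5,3)$ is the class of all non-isomorphic lattices on $n$ elements having exactly five reducible elements, all pairwise comparable, and nullity three, and $\mathscr{B}(j;5,3)$ is the class of all non-isomorphic maximal blocks on $j$ elements having exactly five reducible elements, all pairwise comparable, and nullity three.
   Context: All posets and lattices are finite, and $|\mathscr{C}|$ for a class $\mathscr{C}$ of lattices denotes the number of isomorphism classes in it. An element $x$ of a lattice $L$ is join-reducible (meet-reducible) if there are $y,z\in L$, both distinct from $x$, with $y\vee z=x$ ($y\wedge z=x$); $x$ is reducible if it is join-reducible or meet-reducible. The nullity of a poset is the nullity of its cover graph (undirected graph of the covering relation), i.e. (number of edges) $-$ (number of vertices) $+$ (number of connected components). An RC-lattice is a lattice in which all the reducible elements are pairwise comparable. A block is a lattice in which the least element $0$ and the greatest element $1$ are reducible. If $L=C\oplus \mathbf{B}\oplus C'$ (linear sum) with $\mathbf{B}$ a block and $C,C'$ (possibly empty) chains, then $\mathbf{B}$ is called a maximal block; thus a maximal block on $j$ elements, taken as a lattice in itself, is just a block on $j$ elements. $\mathscr{L}(n;r,k)$ is the class of non-isomorphic RC-lattices on $n$ elements with exactly $r$ reducible elements and nullity $k$; $\mathscr{B}(j;r,k)$ is the class of non-isomorphic maximal blocks on $j$ elements with exactly $r$ reducible elements, all comparable, and nullity $k$. *)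

theory Defs
  imports "HOL-Algebra.Lattice"
begin

section \<open>Reducible elements, RC-lattices and blocks\<close>

definition join_reducible :: "('a, 'm) gorder_scheme \<Rightarrow> 'a \<Rightarrow> bool" where
  "join_reducible L x \<longleftrightarrow> x \<in> carrier L \<and>
     (\<exists>y \<in> carrier L. \<exists>z \<in> carrier L. y \<noteq> x \<and> z \<noteq> x \<and> y \<squnion>\<^bsub>L\<^esub> z = x)"

definition meet_reducible :: "('a, 'm) gorder_scheme \<Rightarrow> 'a \<Rightarrow> bool" where
  "meet_reducible L x \<longleftrightarrow> x \<in> carrier L \<and>
     (\<exists>y \<in> carrier L. \<exists>z \<in> carrier L. y \<noteq> x \<and> z \<noteq> x \<and> y \<sqinter>\<^bsub>L\<^esub> z = x)"

definition reducible :: "('a, 'm) gorder_scheme \<Rightarrow> 'a \<Rightarrow> bool" where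
  "reducible L x \<longleftrightarrow> join_reducible L x \<or> meet_reducible L x"

definition RC_lattice :: "('a, 'm) gorder_scheme \<Rightarrow> bool" where
  "RC_lattice L \<longleftrightarrow> lattice L \<and>
     (\<forall>x y. reducible L x \<longrightarrow> reducible L y \<longrightarrow> x \<sqsubseteq>\<^bsub>L\<^esub> y \<or> y \<sqsubseteq>\<^bsub>L\<^esub> x)"

text \<open>
  A maximal block is a block \<open>B\<close> occurring in a linear sum \<open>C \<oplus> B \<oplus> C'\<close> with possibly
  empty chains \<open>C\<close>, \<open>C'\<close>.  Taken as a lattice in itself it is just a block, so no separate
  notion is introduced for it.
\<close>

definition block :: "('a, 'm) gorder_scheme \<Rightarrow> bool" where
  "block L \<longleftrightarrow> lattice L \<and> reducible L \<bottom>\<^bsub>L\<^esub> \<and> reducible L \<top>\<^bsub>L\<^esub>"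

section \<open>The cover graph and nullity\<close>

definition covered_by :: "('a, 'm) gorder_scheme \<Rightarrow> 'a \<Rightarrow> 'a \<Rightarrow> bool" where
  "covered_by P x y \<longleftrightarrow> x \<in> carrier P \<and> y \<in> carrier P \<and> x \<sqsubset>\<^bsub>P\<^esub> y \<and>
     \<not> (\<exists>z \<in> carrier P. x \<sqsubset>\<^bsub>P\<^esub> z \<and> z \<sqsubset>\<^bsub>P\<^esub> y)"

definition cover_edges :: "('a, 'm) gorder_scheme \<Rightarrow> 'a set set" where
  "cover_edges P = {{x, y} | x y. covered_by P x y}"

definition cover_connected :: "('a, 'm) gorder_scheme \<Rightarrow> ('a \<times> 'a) set" where
  "cover_connected P = {(x, y). {x, y} \<in> cover_edges P}\<^sup>* \<inter> carrier P \<times> carrier P"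

definition cover_components :: "('a, 'm) gorder_scheme \<Rightarrow> 'a set set" where
  "cover_components P = carrier P // cover_connected P"

definition nullity :: "('a, 'm) gorder_scheme \<Rightarrow> int" where
  "nullity P = int (card (cover_edges P)) - int (card (carrier P)) + int (card (cover_components P))"

section \<open>Isomorphism classes\<close>

text \<open>
  Only the restriction of the order to the carrier matters here; values of the order outside
  the carrier are therefore identified by isomorphism.
\<close>

definition order_isomorphic :: "('a, 'm) gorder_scheme \<Rightarrow> ('b, 'n) gorder_scheme \<Rightarrow> bool" where
  "order_isomorphic L M \<longleftrightarrow> (\<exists>f. bij_betw f (carrier L) (carrier M) \<and>
     (\<forall>x \<in> carrier L. \<forall>y \<in> carrier L. x \<sqsubseteq>\<^bsub>L\<^esub> y \<longleftrightarrow> f x \<sqsubseteq>\<^bsub>M\<^esub> f y))"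

definition iso_classes :: "'a gorder set \<Rightarrow> 'a gorder set set" where
  "iso_classes K = K // {(L, M). L \<in> K \<and> M \<in> K \<and> order_isomorphic L M}"

text \<open>
  Every finite lattice has a copy whose carrier is a set of natural numbers, so restricting to
  such carriers loses no isomorphism class.
\<close>

definition RC_lattices :: "nat \<Rightarrow> nat \<Rightarrow> nat \<Rightarrow> nat gorder set" where
  "RC_lattices n r k = {L. RC_lattice L \<and> finite (carrier L) \<and> card (carrier L) = n \<and>
     card {x. reducible L x} = r \<and> nullity L = int k}"

definition RC_blocks :: "nat \<Rightarrow> nat \<Rightarrow> nat \<Rightarrow> nat gorder set" where
  "RC_blocks j r k = {B \<in> RC_lattices j r k. block B}"

text \<open>Elements of the following classes are isomorphism classes, so \<open>card\<close> counts lattices up to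
  isomorphism.\<close>

definition \<L> :: "nat \<Rightarrow> nat \<Rightarrow> nat \<Rightarrow> nat gorder set set" where
  "\<L> n r k = iso_classes (RC_lattices n r k)"

definition \<B> :: "nat \<Rightarrow> nat \<Rightarrow> nat \<Rightarrow> nat gorder set set" where
  "\<B> j r k = iso_classes (RC_blocks j r k)"

end

theory Submission
  imports Defs
begin

text \<open>
  An irreducible least element can be deleted, and a new least element adjoined, without changing
  the reducible elements or the nullity.  So the lattices on \<open>n + 1\<close> elements split, up to
  isomorphism, into those with reducible least element and a copy of those on \<open>n\<close> elements, and
  likewise among the lattices whose greatest element is reducible.  By duality a reducible least
  element and a reducible greatest element are equally frequent, so two summations lead from blocks
  to all lattices, and the multiplicity \<open>i + 1\<close> appears.  Blocks on fewer than 8 elements do not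
  contribute: a cover with an irreducible end is the only upper or the only lower cover of that
  end, and the remaining covers lie in a chain of 5 reducible elements, so nullity 3 (that is,
  \<open>j + 2\<close> covers on \<open>j\<close> elements) forces \<open>j + 2 \<le> 4 + 2 * (j - 5)\<close>.
\<close>

section \<open>Lattices and reducible elements\<close>

text \<open>\<open>join\<close> selects its value by choice from \<open>least\<close>. This
  elementwise form is what allows joins to be compared across different carriers.\<close>

lemma least_Upper_pair_iff:
  assumes "x \<in> carrier L" "y \<in> carrier L"
  shows "least L s (Upper L {x, y}) \<longleftrightarrow>
    s \<in> carrier L \<and> x \<sqsubseteq>\<^bsub>L\<^esub> s \<and> y \<sqsubseteq>\<^bsub>L\<^esub> s \<and> (\<forall>u\<in>carrier L. x \<sqsubseteq>\<^bsub>L\<^esub> u \<longrightarrow> y \<sqsubseteq>\<^bsub>L\<^esub> u \<longrightarrow> s \<sqsubseteq>\<^bsub>L\<^esub> u)"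
  using assms by (auto simp: least_def Upper_def)

lemma greatest_Lower_pair_iff:
  assumes "x \<in> carrier L" "y \<in> carrier L"
  shows "greatest L s (Lower L {x, y}) \<longleftrightarrow>
    s \<in> carrier L \<and> s \<sqsubseteq>\<^bsub>L\<^esub> x \<and> s \<sqsubseteq>\<^bsub>L\<^esub> y \<and> (\<forall>u\<in>carrier L. u \<sqsubseteq>\<^bsub>L\<^esub> x \<longrightarrow> u \<sqsubseteq>\<^bsub>L\<^esub> y \<longrightarrow> u \<sqsubseteq>\<^bsub>L\<^esub> s)"
  using assms by (auto simp: greatest_def Lower_def)

text \<open>A \<open>gorder\<close> carries its own equality. Once that is HOL equality, its
  congruence axioms are trivial and only the usual axioms remain.\<close>

lemma latticeI:
  assumes eq: "(.=\<^bsub>L\<^esub>) = (=)"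
    and refl: "\<And>x. x \<in> carrier L \<Longrightarrow> x \<sqsubseteq>\<^bsub>L\<^esub> x"
    and antisym: "\<And>x y. x \<in> carrier L \<Longrightarrow> y \<in> carrier L \<Longrightarrow> x \<sqsubseteq>\<^bsub>L\<^esub> y \<Longrightarrow> y \<sqsubseteq>\<^bsub>L\<^esub> x \<Longrightarrow> x = y"
    and trans: "\<And>x y z. x \<in> carrier L \<Longrightarrow> y \<in> carrier L \<Longrightarrow> z \<in> carrier L \<Longrightarrow>
      x \<sqsubseteq>\<^bsub>L\<^esub> y \<Longrightarrow> y \<sqsubseteq>\<^bsub>L\<^esub> z \<Longrightarrow> x \<sqsubseteq>\<^bsub>L\<^esub> z"
    and lub: "\<And>x y. x \<in> carrier L \<Longrightarrow> y \<in> carrier L \<Longrightarrow> \<exists>s. least L s (Upper L {x, y})"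
    and glb: "\<And>x y. x \<in> carrier L \<Longrightarrow> y \<in> carrier L \<Longrightarrow> \<exists>s. greatest L s (Lower L {x, y})"
  shows "lattice L"
proof -
  interpret partial_order L
    apply unfold_locales
          apply (simp_all add: eq refl)
    apply (rule antisym; assumption)
    apply (rule trans; assumption)
    done
  show ?thesis
    by unfold_locales (rule lub glb; assumption)+
qed

lemma join_eq_iff:
  assumes "lattice L" "x \<in> carrier L" "y \<in> carrier L"
  shows "x \<squnion>\<^bsub>L\<^esub> y = s \<longleftrightarrow> least L s (Upper L {x, y})"
proof -
  interpret lattice L by fact
  have "least L (x \<squnion>\<^bsub>L\<^esub> y) (Upper L {x, y})"
    unfolding join_def sup_def using sup_of_two_exists[OF assms(2,3)] by (rule someI_ex)
  then show ?thesis using least_unique by blast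
qed

lemma join_reducible_iff:
  assumes "lattice L"
  shows "join_reducible L x \<longleftrightarrow>
    (\<exists>y\<in>carrier L. \<exists>z\<in>carrier L. y \<noteq> x \<and> z \<noteq> x \<and> least L x (Upper L {y, z}))"
  unfolding join_reducible_def using join_eq_iff[OF assms] least_closed by blast

section \<open>Duality between joins and meets\<close>

lemma meet_reducible_dual: "meet_reducible L = join_reducible (inv_gorder L)"
  by (simp add: fun_eq_iff meet_reducible_def join_reducible_def)

lemma join_reducible_dual: "join_reducible L = meet_reducible (inv_gorder L)"
  by (simp add: fun_eq_iff meet_reducible_def join_reducible_def)

lemma reducible_dual: "reducible (inv_gorder L) = reducible L"
  by (auto simp: fun_eq_iff reducible_def meet_reducible_dual[of L] join_reducible_dual[of L])

lemma lattice_dual: "lattice L \<Longrightarrow> lattice (inv_gorder L)"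
  by (rule lattice.dual_lattice)

lemma meet_reducible_iff:
  assumes "lattice L"
  shows "meet_reducible L x \<longleftrightarrow>
    (\<exists>y\<in>carrier L. \<exists>z\<in>carrier L. y \<noteq> x \<and> z \<noteq> x \<and> greatest L x (Lower L {y, z}))"
  using join_reducible_iff[OF lattice_dual[OF assms], of x] by (simp add: meet_reducible_dual)

lemma join_reducibleE:
  assumes "lattice L" "join_reducible L x"
  obtains y z where "y \<in> carrier L" "z \<in> carrier L" "y \<noteq> x" "z \<noteq> x" "least L x (Upper L {y, z})"
  using assms(2) unfolding join_reducible_iff[OF assms(1)] by (elim bexE conjE) (rule that)

lemma join_reducibleI:
  assumes "lattice L" "y \<in> carrier L" "z \<in> carrier L" "y \<noteq> x" "z \<noteq> x" "least L x (Upper L {y, z})"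
  shows "join_reducible L x"
  unfolding join_reducible_iff[OF assms(1)] using assms(2-) by (intro bexI conjI)

lemma meet_reducibleE:
  assumes "lattice L" "meet_reducible L x"
  obtains y z where "y \<in> carrier L" "z \<in> carrier L" "y \<noteq> x" "z \<noteq> x" "greatest L x (Lower L {y, z})"
  using assms(2) unfolding meet_reducible_iff[OF assms(1)] by (elim bexE conjE) (rule that)

lemma meet_reducibleI:
  assumes "lattice L" "y \<in> carrier L" "z \<in> carrier L" "y \<noteq> x" "z \<noteq> x" "greatest L x (Lower L {y, z})"
  shows "meet_reducible L x"
  unfolding meet_reducible_iff[OF assms(1)] using assms(2-) by (intro bexI conjI)

lemma reducible_closed: "reducible L x \<Longrightarrow> x \<in> carrier L"
  by (auto simp: reducible_def join_reducible_def meet_reducible_def)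

section \<open>Least and greatest elements of finite lattices\<close>

lemma finite_lattice_bottom:
  assumes "lattice L" "finite (carrier L)" "carrier L \<noteq> {}"
  shows "\<bottom>\<^bsub>L\<^esub> \<in> carrier L" "\<forall>x\<in>carrier L. \<bottom>\<^bsub>L\<^esub> \<sqsubseteq>\<^bsub>L\<^esub> x"
proof -
  interpret lattice L by fact
  have "greatest L (\<Sqinter>\<^bsub>L\<^esub>(carrier L)) (Lower L (carrier L))"
    by (rule finite_inf_greatest) (use assms in auto)
  \<comment> \<open>The infimum of the whole carrier lies in the carrier, hence it is a least
    element. Its existence validates the choice in the definition of \<open>bottom\<close>.\<close>
  then have "least L (\<Sqinter>\<^bsub>L\<^esub>(carrier L)) (carrier L)"
    by (auto simp: greatest_def least_def Lower_def)
  then have "least L \<bottom>\<^bsub>L\<^esub> (carrier L)"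
    unfolding bottom_def by (rule someI)
  then show "\<bottom>\<^bsub>L\<^esub> \<in> carrier L" "\<forall>x\<in>carrier L. \<bottom>\<^bsub>L\<^esub> \<sqsubseteq>\<^bsub>L\<^esub> x"
    by (auto simp: least_def)
qed

lemma finite_lattice_top:
  assumes "lattice L" "finite (carrier L)" "carrier L \<noteq> {}"
  shows "\<top>\<^bsub>L\<^esub> \<in> carrier L" "\<forall>x\<in>carrier L. x \<sqsubseteq>\<^bsub>L\<^esub> \<top>\<^bsub>L\<^esub>"
  using finite_lattice_bottom[OF lattice_dual[OF assms(1)]] assms(2,3) by auto

lemma bottom_eqI:
  assumes "lattice L" "b \<in> carrier L" "\<forall>x\<in>carrier L. b \<sqsubseteq>\<^bsub>L\<^esub> x"
  shows "\<bottom>\<^bsub>L\<^esub> = b"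
proof -
  interpret lattice L by fact
  have "least L b (carrier L)" using assms by (auto simp: least_def)
  moreover from this have "least L \<bottom>\<^bsub>L\<^esub> (carrier L)" unfolding bottom_def by (rule someI)
  ultimately show ?thesis using least_unique by blast
qed

lemma top_eqI:
  assumes "lattice L" "t \<in> carrier L" "\<forall>x\<in>carrier L. x \<sqsubseteq>\<^bsub>L\<^esub> t"
  shows "\<top>\<^bsub>L\<^esub> = t"
  using bottom_eqI[OF lattice_dual[OF assms(1)], of t] assms by simp

section \<open>Nullity of finite lattices\<close>

text \<open>Directed counterpart of \<open>cover_edges\<close>: with oriented covers, the lower and
  the upper end can be projected out when counting.\<close>

definition cover_pairs :: "('a, 'm) gorder_scheme \<Rightarrow> ('a \<times> 'a) set" where
  "cover_pairs P = {(x, y). covered_by P x y}"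

lemma covered_by_iff:
  assumes "lattice L"
  shows "covered_by L x y \<longleftrightarrow> x \<in> carrier L \<and> y \<in> carrier L \<and> x \<sqsubseteq>\<^bsub>L\<^esub> y \<and> x \<noteq> y \<and>
    (\<forall>z\<in>carrier L. x \<sqsubseteq>\<^bsub>L\<^esub> z \<longrightarrow> z \<sqsubseteq>\<^bsub>L\<^esub> y \<longrightarrow> z = x \<or> z = y)"
proof -
  interpret lattice L by fact
  show ?thesis by (auto simp: covered_by_def lless_eq)
qed

lemma covered_by_dual:
  assumes "lattice L"
  shows "covered_by (inv_gorder L) x y \<longleftrightarrow> covered_by L y x"
  unfolding covered_by_iff[OF assms] covered_by_iff[OF lattice_dual[OF assms]] by auto

lemma finite_cover_pairs: "finite (carrier P) \<Longrightarrow> finite (cover_pairs P)"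
  by (rule finite_subset[of _ "carrier P \<times> carrier P"]) (auto simp: cover_pairs_def covered_by_def)

text \<open>By antisymmetry an edge determines its orientation, so forgetting the orientation is
  injective.\<close>

lemma card_cover_edges:
  assumes "lattice L"
  shows "card (cover_edges L) = card (cover_pairs L)"
proof -
  interpret lattice L by fact
  have "cover_edges L = (\<lambda>(x, y). {x, y}) ` cover_pairs L"
    by (auto simp: cover_edges_def cover_pairs_def)
  moreover have "inj_on (\<lambda>(x, y). {x, y}) (cover_pairs L)"
    by (auto simp: inj_on_def cover_pairs_def covered_by_iff[OF assms] doubleton_eq_iff intro: le_antisym)
  ultimately show ?thesis by (simp add: card_image)
qed

lemma ex_cover:
  assumes "lattice L" "finite (carrier L)" "x \<in> carrier L" "y \<in> carrier L" "x \<sqsubseteq>\<^bsub>L\<^esub> y" "x \<noteq> y"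
  shows "\<exists>z. covered_by L x z \<and> z \<sqsubseteq>\<^bsub>L\<^esub> y"
proof -
  interpret lattice L by fact
  define I where "I v = {u\<in>carrier L. x \<sqsubseteq>\<^bsub>L\<^esub> u \<and> u \<sqsubseteq>\<^bsub>L\<^esub> v}" for v
  define S where "S = {v\<in>carrier L. x \<sqsubseteq>\<^bsub>L\<^esub> v \<and> v \<noteq> x \<and> v \<sqsubseteq>\<^bsub>L\<^esub> y}"
  have "y \<in> S" using assms by (auto simp: S_def)
  \<comment> \<open>Among the elements strictly above \<open>x\<close> and below \<open>y\<close>,
    \<open>z\<close> is one whose interval from \<open>x\<close> has the fewest elements. An element
    strictly between \<open>x\<close> and \<open>z\<close> would have a smaller interval.\<close>
  then obtain z where z: "z \<in> S" and min: "\<And>v. v \<in> S \<Longrightarrow> card (I z) \<le> card (I v)"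
    using ex_has_least_nat[of "\<lambda>v. v \<in> S" y "\<lambda>v. card (I v)"] by auto
  have "v = x \<or> v = z" if v: "v \<in> carrier L" "x \<sqsubseteq>\<^bsub>L\<^esub> v" "v \<sqsubseteq>\<^bsub>L\<^esub> z" for v
  proof (rule ccontr)
    assume n: "\<not> (v = x \<or> v = z)"
    have "v \<in> S" using v z n assms(4) le_trans[of v z y] by (auto simp: S_def)
    moreover have "I v \<subset> I z"
    proof -
      have "I v \<subseteq> I z" using v z by (auto simp: I_def S_def intro: le_trans)
      moreover have "z \<in> I z" "z \<notin> I v" using v z n by (auto simp: I_def S_def)
      ultimately show ?thesis by blast
    qed
    then have "card (I v) < card (I z)" by (intro psubset_card_mono) (auto simp: I_def assms)
    ultimately show False using min by fastforce
  qed
  then show ?thesis using z assms by (auto simp: covered_by_iff S_def)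
qed

text \<open>Every element climbs along covers to the greatest element, by induction on the number of
  elements above it. Adjacency is symmetric, so any two elements are joined through the top.\<close>

lemma finite_lattice_connected:
  assumes "lattice L" "finite (carrier L)" "carrier L \<noteq> {}"
  shows "cover_connected L = carrier L \<times> carrier L"
proof -
  interpret lattice L by fact
  define E where "E = {(x, y). {x, y} \<in> cover_edges L}"
  have "sym E" by (auto simp: E_def sym_def insert_commute)
  have up: "(x, \<top>\<^bsub>L\<^esub>) \<in> E\<^sup>*" if "x \<in> carrier L" for x
    using that
  proof (induction "card {u\<in>carrier L. x \<sqsubseteq>\<^bsub>L\<^esub> u}" arbitrary: x rule: less_induct)
    case less
    show ?case
    proof (cases "x = \<top>\<^bsub>L\<^esub>")
      case False
      then obtain z where z: "covered_by L x z"
        using ex_cover[OF assms(1,2) less.prems] finite_lattice_top[OF assms] less.prems by metis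
      then have z': "z \<in> carrier L" "x \<sqsubseteq>\<^bsub>L\<^esub> z" "x \<noteq> z" by (auto simp: covered_by_iff[OF assms(1)])
      have "{u\<in>carrier L. z \<sqsubseteq>\<^bsub>L\<^esub> u} \<subset> {u\<in>carrier L. x \<sqsubseteq>\<^bsub>L\<^esub> u}"
      proof -
        have "{u\<in>carrier L. z \<sqsubseteq>\<^bsub>L\<^esub> u} \<subseteq> {u\<in>carrier L. x \<sqsubseteq>\<^bsub>L\<^esub> u}"
          using le_trans[OF z'(2)] z' less.prems by blast
        moreover have "\<not> z \<sqsubseteq>\<^bsub>L\<^esub> x" using z' less.prems le_antisym by blast
        ultimately show ?thesis using less.prems by blast
      qed
      then have "card {u\<in>carrier L. z \<sqsubseteq>\<^bsub>L\<^esub> u} < card {u\<in>carrier L. x \<sqsubseteq>\<^bsub>L\<^esub> u}"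
        by (intro psubset_card_mono) (auto simp: assms)
      then have "(z, \<top>\<^bsub>L\<^esub>) \<in> E\<^sup>*" using less.hyps z' by blast
      moreover have "(x, z) \<in> E" using z by (auto simp: E_def cover_edges_def)
      ultimately show ?thesis by (rule converse_rtrancl_into_rtrancl[rotated])
    qed simp
  qed
  have "(x, y) \<in> E\<^sup>*" if "x \<in> carrier L" "y \<in> carrier L" for x y
    using up[OF that(1)] symD[OF sym_rtrancl[OF \<open>sym E\<close>] up[OF that(2)]] by (rule rtrancl_trans)
  then show ?thesis by (auto simp: cover_connected_def E_def)
qed

text \<open>The cover graph has a single component, which reduces nullity to a count of
  covers.\<close>

lemma nullity_finite_lattice:
  assumes "lattice L" "finite (carrier L)" "carrier L \<noteq> {}"
  shows "nullity L = int (card (cover_pairs L)) - int (card (carrier L)) + 1"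
proof -
  have "cover_components L = {carrier L}"
    using assms(3) by (auto simp: cover_components_def finite_lattice_connected[OF assms] quotient_def)
  then show ?thesis by (simp add: nullity_def card_cover_edges[OF assms(1)])
qed

section \<open>Adjoining a least element\<close>

text \<open>Neither structure is assumed to be a lattice, so the locale serves both for deleting
  \<open>b\<close> from a lattice \<open>L\<close> and for adjoining \<open>b\<close> to a lattice
  \<open>M\<close>. The assumption \<open>le_b\<close> stands in for antisymmetry at
  \<open>b\<close>.\<close>

locale bottom_extension =
  fixes L M :: "'a gorder" and b :: 'a
  assumes M_eq: "M = L\<lparr>carrier := carrier L - {b}\<rparr>"
    and eq_L: "(.=\<^bsub>L\<^esub>) = (=)"
    and b_closed: "b \<in> carrier L"
    and b_le: "x \<in> carrier L \<Longrightarrow> b \<sqsubseteq>\<^bsub>L\<^esub> x"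
    and le_b: "x \<in> carrier L \<Longrightarrow> x \<sqsubseteq>\<^bsub>L\<^esub> b \<Longrightarrow> x = b"
    and fin: "finite (carrier L)"
    and nonempty: "carrier M \<noteq> {}"
begin

lemma carrier_M: "carrier M = carrier L - {b}"
  by (simp add: M_eq)

lemma le_M: "x \<sqsubseteq>\<^bsub>M\<^esub> y \<longleftrightarrow> x \<sqsubseteq>\<^bsub>L\<^esub> y"
  by (simp add: M_eq)

text \<open>\<open>b\<close> is not an upper bound of any element of \<open>M\<close>, so both
  carriers give the same upper bounds.\<close>

lemma lub_M_iff:
  assumes "x \<in> carrier M" "y \<in> carrier M"
  shows "least M s (Upper M {x, y}) \<longleftrightarrow> least L s (Upper L {x, y})"
proof -
  have "x \<in> carrier L" "y \<in> carrier L" "x \<noteq> b" using assms by (auto simp: carrier_M)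
  then show ?thesis
    unfolding least_Upper_pair_iff[OF assms] least_Upper_pair_iff[OF \<open>x \<in> carrier L\<close> \<open>y \<in> carrier L\<close>]
    unfolding carrier_M le_M using le_b[of x] by blast
qed

text \<open>\<open>L\<close> has the extra lower bound \<open>b\<close>, but it lies below
  \<open>s\<close> anyway. The condition \<open>s \<noteq> b\<close> places \<open>s\<close> in
  \<open>M\<close>.\<close>

lemma glb_M_iff:
  assumes "x \<in> carrier M" "y \<in> carrier M" "s \<noteq> b"
  shows "greatest M s (Lower M {x, y}) \<longleftrightarrow> greatest L s (Lower L {x, y})"
proof -
  have "x \<in> carrier L" "y \<in> carrier L" using assms by (auto simp: carrier_M)
  then show ?thesis
    unfolding greatest_Lower_pair_iff[OF assms(1,2)]
      greatest_Lower_pair_iff[OF \<open>x \<in> carrier L\<close> \<open>y \<in> carrier L\<close>]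
    unfolding carrier_M le_M using b_le[of s] assms(3) by blast
qed

text \<open>Only a pair of \<open>M\<close> whose meet in \<open>L\<close> is \<open>b\<close> could
  lose its meet, and such a pair would make \<open>b\<close> meet-reducible.\<close>

lemma lattice_M:
  assumes "lattice L" "\<not> meet_reducible L b"
  shows "lattice M"
proof -
  interpret L: lattice L by fact
  have sub: "x \<in> carrier L" if "x \<in> carrier M" for x using that by (simp add: carrier_M)
  show ?thesis
  proof (rule latticeI)
    show "\<exists>s. least M s (Upper M {x, y})" if "x \<in> carrier M" "y \<in> carrier M" for x y
      using L.sup_of_two_exists[OF that[THEN sub]] lub_M_iff[OF that] by blast
    show "\<exists>s. greatest M s (Lower M {x, y})" if xy: "x \<in> carrier M" "y \<in> carrier M" for x y
    proof -
      obtain s where s: "greatest L s (Lower L {x, y})"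
        using L.inf_of_two_exists[OF xy[THEN sub]] by blast
      have "x \<noteq> b" "y \<noteq> b" using xy by (auto simp: carrier_M)
      then have "s \<noteq> b" using assms(2) s meet_reducibleI[OF assms(1) xy[THEN sub], of s] by auto
      then show ?thesis using s glb_M_iff[OF xy] by blast
    qed
    show "x = y" if "x \<in> carrier M" "y \<in> carrier M" "x \<sqsubseteq>\<^bsub>M\<^esub> y" "y \<sqsubseteq>\<^bsub>M\<^esub> x" for x y
      using that le_M sub L.le_antisym by metis
    show "x \<sqsubseteq>\<^bsub>M\<^esub> z" if "x \<in> carrier M" "y \<in> carrier M" "z \<in> carrier M" "x \<sqsubseteq>\<^bsub>M\<^esub> y" "y \<sqsubseteq>\<^bsub>M\<^esub> z" for x y z
      using that le_M sub L.le_trans by metis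
  qed (simp_all add: M_eq eq_L)
qed

text \<open>A pair containing \<open>b\<close> is comparable, so its bounds are immediate. Any other
  pair keeps its bounds from \<open>M\<close>.\<close>

lemma lattice_L:
  assumes "lattice M"
  shows "lattice L"
proof -
  interpret M: lattice M by fact
  have cases: "x = b \<or> x \<in> carrier M" if "x \<in> carrier L" for x using that by (auto simp: carrier_M)
  have refl: "x \<sqsubseteq>\<^bsub>L\<^esub> x" if "x \<in> carrier L" for x
    using cases[OF that] M.le_refl b_le[OF b_closed] le_M by blast
  show ?thesis
  proof (rule latticeI)
    show "x = y" if "x \<in> carrier L" "y \<in> carrier L" "x \<sqsubseteq>\<^bsub>L\<^esub> y" "y \<sqsubseteq>\<^bsub>L\<^esub> x" for x y
      using cases[OF that(1)] cases[OF that(2)] M.le_antisym[unfolded le_M] that le_b by metis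
    show "x \<sqsubseteq>\<^bsub>L\<^esub> z"
      if "x \<in> carrier L" "y \<in> carrier L" "z \<in> carrier L" "x \<sqsubseteq>\<^bsub>L\<^esub> y" "y \<sqsubseteq>\<^bsub>L\<^esub> z" for x y z
      using cases[OF that(1)] cases[OF that(2)] cases[OF that(3)] M.le_trans[unfolded le_M] that le_b b_le
      by metis
    show "\<exists>s. least L s (Upper L {x, y})" if xy: "x \<in> carrier L" "y \<in> carrier L" for x y
    proof (cases "x = b \<or> y = b")
      case True
      then show ?thesis
        unfolding least_Upper_pair_iff[OF xy] using xy b_le refl by blast
    next
      case False
      then have "x \<in> carrier M" "y \<in> carrier M" using cases xy by auto
      then show ?thesis using M.sup_of_two_exists lub_M_iff by metis
    qed
    show "\<exists>s. greatest L s (Lower L {x, y})" if xy: "x \<in> carrier L" "y \<in> carrier L" for x y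
    proof (cases "x = b \<or> y = b")
      case True
      then show ?thesis
        unfolding greatest_Lower_pair_iff[OF xy] using xy b_le refl b_closed by metis
    next
      case False
      then have xy': "x \<in> carrier M" "y \<in> carrier M" using cases xy by auto
      then obtain s where s: "greatest M s (Lower M {x, y})" using M.inf_of_two_exists by blast
      then have "s \<in> carrier M" by (rule greatest_closed)
      then have "s \<noteq> b" by (simp add: carrier_M)
      then show ?thesis using s glb_M_iff[OF xy'] by blast
    qed
  qed (use eq_L refl in auto)
qed

lemma fin_M: "finite (carrier M)"
  by (simp add: carrier_M fin)

lemma card_L: "card (carrier L) = Suc (card (carrier M))"
  using card_Suc_Diff1[OF fin b_closed] by (simp add: carrier_M)

section \<open>Reducible elements, covers and nullity when a least element is adjoined\<close>

context
  assumes lat: "lattice M"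
begin

text \<open>Joinands of \<open>b\<close> lie below \<open>b\<close>, hence equal it. Two elements
  other than \<open>b\<close> have a meet in \<open>M\<close>, and this common lower bound is not
  below \<open>b\<close>.\<close>

lemma b_irreducible: "\<not> reducible L b"
proof
  assume "reducible L b"
  then consider "join_reducible L b" | "meet_reducible L b" by (auto simp: reducible_def)
  then show False
  proof cases
    case 1
    then obtain y z where yz: "y \<in> carrier L" "z \<in> carrier L" "y \<noteq> b" "least L b (Upper L {y, z})"
      by (rule join_reducibleE[OF lattice_L[OF lat]])
    then show False using least_Upper_pair_iff le_b by metis
  next
    case 2
    then obtain y z where "y \<in> carrier L" "z \<in> carrier L" "y \<noteq> b" "z \<noteq> b"
      and b: "greatest L b (Lower L {y, z})"
      by (rule meet_reducibleE[OF lattice_L[OF lat]])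
    then have yz: "y \<in> carrier M" "z \<in> carrier M" by (simp_all add: carrier_M)
    interpret M: lattice M by (rule lat)
    obtain s where s: "greatest M s (Lower M {y, z})" using M.inf_of_two_exists[OF yz] by blast
    have c: "y \<in> carrier L" "z \<in> carrier L" using yz carrier_M by auto
    have "s \<in> carrier M" "s \<sqsubseteq>\<^bsub>L\<^esub> y" "s \<sqsubseteq>\<^bsub>L\<^esub> z"
      using s unfolding greatest_Lower_pair_iff[OF yz] le_M by auto
    then show False
      using b le_b[of s] unfolding greatest_Lower_pair_iff[OF c] by (auto simp: carrier_M)
  qed
qed

lemma reducible_iff: "reducible L x \<longleftrightarrow> reducible M x"
proof (cases "x \<in> carrier M")
  case False
  then show ?thesis
    using b_irreducible reducible_closed[of L x] reducible_closed[of M x] carrier_M by auto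
next
  case True
  then have x: "x \<in> carrier L" "x \<noteq> b" by (auto simp: carrier_M)
  interpret L: lattice L by (rule lattice_L[OF lat])
  note L = L.lattice_axioms
  have "join_reducible M x" if red: "join_reducible L x"
  proof -
    obtain y z where yz: "y \<in> carrier L" "z \<in> carrier L" "y \<noteq> x" "z \<noteq> x"
      and lub: "least L x (Upper L {y, z})"
      using red by (rule join_reducibleE[OF L])
    have "y \<sqsubseteq>\<^bsub>L\<^esub> x" "z \<sqsubseteq>\<^bsub>L\<^esub> x"
      and min: "\<And>u. u \<in> carrier L \<Longrightarrow> y \<sqsubseteq>\<^bsub>L\<^esub> u \<Longrightarrow> z \<sqsubseteq>\<^bsub>L\<^esub> u \<Longrightarrow> x \<sqsubseteq>\<^bsub>L\<^esub> u"
      using lub unfolding least_Upper_pair_iff[OF yz(1,2)] by auto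
    \<comment> \<open>If one joinand were \<open>b\<close>, the join \<open>x\<close> would equal
      the other joinand, contrary to the choice of the witnesses.\<close>
    then have "y \<noteq> b" "z \<noteq> b"
      using yz x b_le L.le_antisym L.le_refl by metis+
    then have "y \<in> carrier M" "z \<in> carrier M" using yz by (simp_all add: carrier_M)
    then show ?thesis using join_reducibleI[OF lat] yz lub lub_M_iff by blast
  qed
  moreover have "join_reducible L x" if red: "join_reducible M x"
  proof -
    obtain y z where yz: "y \<in> carrier M" "z \<in> carrier M" "y \<noteq> x" "z \<noteq> x"
      and lub: "least M x (Upper M {y, z})"
      using red by (rule join_reducibleE[OF lat])
    moreover from yz have "y \<in> carrier L" "z \<in> carrier L" by (simp_all add: carrier_M)
    ultimately show ?thesis using join_reducibleI[OF L] lub_M_iff by blast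
  qed
  moreover have "meet_reducible M x" if red: "meet_reducible L x"
  proof -
    obtain y z where yz: "y \<in> carrier L" "z \<in> carrier L" "y \<noteq> x" "z \<noteq> x"
      and glb: "greatest L x (Lower L {y, z})"
      using red by (rule meet_reducibleE[OF L])
    have "x \<sqsubseteq>\<^bsub>L\<^esub> y" "x \<sqsubseteq>\<^bsub>L\<^esub> z"
      using glb unfolding greatest_Lower_pair_iff[OF yz(1,2)] by auto
    \<comment> \<open>The witnesses lie above \<open>x\<close>, and only \<open>b\<close> itself
      lies below \<open>b\<close>.\<close>
    then have "y \<noteq> b" "z \<noteq> b" using x le_b by metis+
    then have "y \<in> carrier M" "z \<in> carrier M" using yz by (simp_all add: carrier_M)
    then show ?thesis using meet_reducibleI[OF lat] yz glb glb_M_iff[OF _ _ x(2)] by blast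
  qed
  moreover have "meet_reducible L x" if red: "meet_reducible M x"
  proof -
    obtain y z where yz: "y \<in> carrier M" "z \<in> carrier M" "y \<noteq> x" "z \<noteq> x"
      and glb: "greatest M x (Lower M {y, z})"
      using red by (rule meet_reducibleE[OF lat])
    moreover from yz have "y \<in> carrier L" "z \<in> carrier L" by (simp_all add: carrier_M)
    ultimately show ?thesis using meet_reducibleI[OF L] glb_M_iff[OF _ _ x(2)] by blast
  qed
  ultimately show ?thesis by (auto simp: reducible_def)
qed

lemma reducible_eq: "reducible L = reducible M"
  by (simp add: fun_eq_iff reducible_iff)

lemma bottom_L: "\<bottom>\<^bsub>L\<^esub> = b"
  using bottom_eqI[OF lattice_L[OF lat] b_closed] b_le by blast

lemma top_M: "\<top>\<^bsub>M\<^esub> = \<top>\<^bsub>L\<^esub>"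
proof (rule top_eqI[OF lat])
  have "carrier L \<noteq> {}" using b_closed by blast
  note L = finite_lattice_top[OF lattice_L[OF lat] fin this]
  obtain x where x: "x \<in> carrier L" "x \<noteq> b" using nonempty by (auto simp: carrier_M)
  then have "\<top>\<^bsub>L\<^esub> \<noteq> b" using le_b[OF x(1)] L(2) by metis
  then show "\<top>\<^bsub>L\<^esub> \<in> carrier M" using L(1) by (simp add: carrier_M)
  show "\<forall>x\<in>carrier M. x \<sqsubseteq>\<^bsub>M\<^esub> \<top>\<^bsub>L\<^esub>" using L(2) by (simp add: carrier_M le_M)
qed

text \<open>Every element other than \<open>b\<close> is above the least element of
  \<open>M\<close>, so this is the only upper cover of \<open>b\<close>. No interval starting in
  \<open>M\<close> contains \<open>b\<close>, so the other covers are unchanged.\<close>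

lemma cover_pairs_L: "cover_pairs L = insert (b, \<bottom>\<^bsub>M\<^esub>) (cover_pairs M)"
proof -
  note L = lattice_L[OF lat]
  interpret L: lattice L by (rule L)
  have M: "\<bottom>\<^bsub>M\<^esub> \<in> carrier L" "\<bottom>\<^bsub>M\<^esub> \<noteq> b" "\<And>x. x \<in> carrier L \<Longrightarrow> x \<noteq> b \<Longrightarrow> \<bottom>\<^bsub>M\<^esub> \<sqsubseteq>\<^bsub>L\<^esub> x"
    using finite_lattice_bottom[OF lat fin_M nonempty] by (simp_all add: carrier_M le_M)
  have "covered_by L b y \<longleftrightarrow> y = \<bottom>\<^bsub>M\<^esub>" for y
    unfolding covered_by_iff[OF L] using M b_le L.le_antisym b_closed by metis
  moreover have "covered_by L x y \<longleftrightarrow> covered_by M x y" if "x \<noteq> b" for x y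
    unfolding covered_by_iff[OF L] covered_by_iff[OF lat] carrier_M le_M
    using that le_b by blast
  moreover have "\<not> covered_by M b y" for y
    by (simp add: covered_by_def carrier_M)
  ultimately have "covered_by L x y \<longleftrightarrow> (x, y) = (b, \<bottom>\<^bsub>M\<^esub>) \<or> covered_by M x y" for x y
    by (cases "x = b") simp_all
  then show ?thesis by (auto simp: cover_pairs_def)
qed

text \<open>One vertex and one edge are added, and both graphs are connected.\<close>

lemma nullity_L: "nullity L = nullity M"
proof -
  have "(b, \<bottom>\<^bsub>M\<^esub>) \<notin> cover_pairs M" by (simp add: cover_pairs_def covered_by_def carrier_M)
  then have "card (cover_pairs L) = Suc (card (cover_pairs M))"
    using finite_cover_pairs[OF fin_M] by (simp add: cover_pairs_L)
  then show ?thesis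
    using nullity_finite_lattice[OF lattice_L[OF lat] fin] nullity_finite_lattice[OF lat fin_M nonempty]
      b_closed card_L by auto
qed

lemma RC_lattice_iff: "RC_lattice L \<longleftrightarrow> RC_lattice M"
  by (simp add: RC_lattice_def lat lattice_L[OF lat] reducible_iff le_M)

end

end

section \<open>Invariance under isomorphism\<close>

definition order_iso_map :: "('a \<Rightarrow> 'b) \<Rightarrow> ('a, 'm) gorder_scheme \<Rightarrow> ('b, 'n) gorder_scheme \<Rightarrow> bool" where
  "order_iso_map f L M \<longleftrightarrow> bij_betw f (carrier L) (carrier M) \<and>
     (\<forall>x\<in>carrier L. \<forall>y\<in>carrier L. x \<sqsubseteq>\<^bsub>L\<^esub> y \<longleftrightarrow> f x \<sqsubseteq>\<^bsub>M\<^esub> f y)"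

lemma order_isomorphic_iff: "order_isomorphic L M \<longleftrightarrow> (\<exists>f. order_iso_map f L M)"
  by (simp add: order_isomorphic_def order_iso_map_def)

lemma order_iso_map_inv:
  assumes "order_iso_map f L M"
  shows "order_iso_map (inv_into (carrier L) f) M L"
proof -
  have b: "bij_betw f (carrier L) (carrier M)" using assms by (simp add: order_iso_map_def)
  have "inv_into (carrier L) f x \<in> carrier L" "f (inv_into (carrier L) f x) = x" if "x \<in> carrier M" for x
    using bij_betw_inv_into_right[OF b that] bij_betwE[OF bij_betw_inv_into[OF b]] that by auto
  then show ?thesis using assms bij_betw_inv_into[OF b] by (simp add: order_iso_map_def)
qed

lemma order_iso_map_comp:
  assumes "order_iso_map f L M" "order_iso_map g M N"
  shows "order_iso_map (g \<circ> f) L N"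
proof -
  have f: "bij_betw f (carrier L) (carrier M)" and g: "bij_betw g (carrier M) (carrier N)"
    using assms by (auto simp: order_iso_map_def)
  show ?thesis
    using assms bij_betw_trans[OF f g] bij_betwE[OF f] by (simp add: order_iso_map_def)
qed

lemma order_isomorphic_refl: "order_isomorphic L L"
  unfolding order_isomorphic_iff by (rule exI[of _ id]) (simp add: order_iso_map_def)

lemma order_isomorphic_sym: "order_isomorphic L M \<Longrightarrow> order_isomorphic M L"
  unfolding order_isomorphic_iff using order_iso_map_inv by blast

lemma order_isomorphic_trans:
  "order_isomorphic L M \<Longrightarrow> order_isomorphic M N \<Longrightarrow> order_isomorphic L N"
  unfolding order_isomorphic_iff using order_iso_map_comp by blast

lemma order_isomorphic_dual:
  "order_isomorphic (inv_gorder L) (inv_gorder M) \<longleftrightarrow> order_isomorphic L M"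
proof -
  have "order_iso_map f (inv_gorder L) (inv_gorder M) \<longleftrightarrow> order_iso_map f L M" for f
    unfolding order_iso_map_def by (simp, blast)
  then show ?thesis by (simp add: order_isomorphic_iff)
qed

text \<open>An order isomorphism says nothing about the equality stored in \<open>M\<close>, so
  \<open>eq_M\<close> is required for \<open>M\<close> to be a lattice as well.\<close>

locale lattice_iso =
  fixes L M :: "'a gorder" and f :: "'a \<Rightarrow> 'a"
  assumes lat: "lattice L" and eq_M: "(.=\<^bsub>M\<^esub>) = (=)" and iso: "order_iso_map f L M"
begin

lemma carrier_M: "carrier M = f ` carrier L"
  using iso by (auto simp: order_iso_map_def bij_betw_def)

lemma f_le: "x \<in> carrier L \<Longrightarrow> y \<in> carrier L \<Longrightarrow> f x \<sqsubseteq>\<^bsub>M\<^esub> f y \<longleftrightarrow> x \<sqsubseteq>\<^bsub>L\<^esub> y"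
  using iso by (auto simp: order_iso_map_def)

lemma f_inj: "inj_on f (carrier L)"
  using iso by (auto simp: order_iso_map_def bij_betw_def)

lemma f_eq: "x \<in> carrier L \<Longrightarrow> y \<in> carrier L \<Longrightarrow> f x = f y \<longleftrightarrow> x = y"
  using f_inj by (auto simp: inj_on_def)

lemma lub_f_iff:
  assumes "x \<in> carrier L" "y \<in> carrier L" "s \<in> carrier L"
  shows "least M (f s) (Upper M {f x, f y}) \<longleftrightarrow> least L s (Upper L {x, y})"
proof -
  have c: "f x \<in> carrier M" "f y \<in> carrier M" using assms carrier_M by auto
  show ?thesis
    unfolding least_Upper_pair_iff[OF assms(1,2)] least_Upper_pair_iff[OF c]
    unfolding carrier_M using assms by (auto simp: f_le)
qed

lemma glb_f_iff:
  assumes "x \<in> carrier L" "y \<in> carrier L" "s \<in> carrier L"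
  shows "greatest M (f s) (Lower M {f x, f y}) \<longleftrightarrow> greatest L s (Lower L {x, y})"
proof -
  have c: "f x \<in> carrier M" "f y \<in> carrier M" using assms carrier_M by auto
  show ?thesis
    unfolding greatest_Lower_pair_iff[OF assms(1,2)] greatest_Lower_pair_iff[OF c]
    unfolding carrier_M using assms by (auto simp: f_le)
qed

lemma lattice_M: "lattice M"
proof -
  interpret lattice L by (rule lat)
  have "\<exists>s. least M s (Upper M {f x, f y})" if "x \<in> carrier L" "y \<in> carrier L" for x y
    using sup_of_two_exists[OF that] lub_f_iff[OF that] least_closed by blast
  moreover have "\<exists>s. greatest M s (Lower M {f x, f y})" if "x \<in> carrier L" "y \<in> carrier L" for x y
    using inf_of_two_exists[OF that] glb_f_iff[OF that] greatest_closed by blast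
  ultimately show ?thesis
    by (intro latticeI) (auto simp: eq_M carrier_M f_le f_eq intro: le_trans le_antisym)
qed

lemma reducible_f_iff:
  assumes "x \<in> carrier L"
  shows "reducible M (f x) \<longleftrightarrow> reducible L x"
proof -
  have "join_reducible M (f x) \<longleftrightarrow> join_reducible L x"
    unfolding join_reducible_iff[OF lat] join_reducible_iff[OF lattice_M] carrier_M
    using assms by (auto simp: lub_f_iff f_eq)
  moreover have "meet_reducible M (f x) \<longleftrightarrow> meet_reducible L x"
    unfolding meet_reducible_iff[OF lat] meet_reducible_iff[OF lattice_M] carrier_M
    using assms by (auto simp: glb_f_iff f_eq)
  ultimately show ?thesis by (simp add: reducible_def)
qed

lemma reducible_M: "{x. reducible M x} = f ` {x. reducible L x}"
proof -
  have "reducible M u \<longleftrightarrow> (\<exists>x\<in>carrier L. u = f x \<and> reducible L x)" for u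
    using reducible_f_iff reducible_closed[of M u] unfolding carrier_M by blast
  then show ?thesis using reducible_closed[of L] by auto
qed

lemma card_reducible: "card {x. reducible M x} = card {x. reducible L x}"
  unfolding reducible_M
  by (rule card_image) (rule inj_on_subset[OF f_inj], auto intro: reducible_closed)

lemma card_carrier: "card (carrier M) = card (carrier L)"
  unfolding carrier_M by (rule card_image) (rule f_inj)

lemma RC_lattice_M: "RC_lattice L \<Longrightarrow> RC_lattice M"
proof -
  assume L: "RC_lattice L"
  have "u \<sqsubseteq>\<^bsub>M\<^esub> v \<or> v \<sqsubseteq>\<^bsub>M\<^esub> u" if uv: "reducible M u" "reducible M v" for u v
  proof -
    obtain x y where xy: "reducible L x" "reducible L y" "u = f x" "v = f y"
      using uv reducible_M by blast
    then have "x \<in> carrier L" "y \<in> carrier L" by (simp_all add: reducible_closed)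
    moreover have "x \<sqsubseteq>\<^bsub>L\<^esub> y \<or> y \<sqsubseteq>\<^bsub>L\<^esub> x" using L xy by (simp add: RC_lattice_def)
    ultimately show ?thesis using f_le xy by simp
  qed
  then show ?thesis using lattice_M by (simp add: RC_lattice_def)
qed

context
  assumes fin: "finite (carrier L)" and nonempty: "carrier L \<noteq> {}"
begin

lemma bottom_M: "\<bottom>\<^bsub>M\<^esub> = f \<bottom>\<^bsub>L\<^esub>"
proof (rule bottom_eqI[OF lattice_M])
  note L = finite_lattice_bottom[OF lat fin nonempty]
  show "f \<bottom>\<^bsub>L\<^esub> \<in> carrier M" using L(1) by (simp add: carrier_M)
  show "\<forall>x\<in>carrier M. f \<bottom>\<^bsub>L\<^esub> \<sqsubseteq>\<^bsub>M\<^esub> x" using L by (simp add: carrier_M f_le)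
qed

lemma top_M: "\<top>\<^bsub>M\<^esub> = f \<top>\<^bsub>L\<^esub>"
proof (rule top_eqI[OF lattice_M])
  note L = finite_lattice_top[OF lat fin nonempty]
  show "f \<top>\<^bsub>L\<^esub> \<in> carrier M" using L(1) by (simp add: carrier_M)
  show "\<forall>x\<in>carrier M. x \<sqsubseteq>\<^bsub>M\<^esub> f \<top>\<^bsub>L\<^esub>" using L by (simp add: carrier_M f_le)
qed

lemma cover_pairs_M: "cover_pairs M = map_prod f f ` cover_pairs L"
proof -
  have "covered_by M (f x) (f y) \<longleftrightarrow> covered_by L x y" if "x \<in> carrier L" "y \<in> carrier L" for x y
    unfolding covered_by_iff[OF lat] covered_by_iff[OF lattice_M] carrier_M
    using that by (auto simp: f_le f_eq)
  moreover have "x \<in> carrier L \<and> y \<in> carrier L" if "covered_by L x y" for x y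
    using that by (auto simp: covered_by_def)
  moreover have "u \<in> f ` carrier L \<and> v \<in> f ` carrier L" if "covered_by M u v" for u v
    using that by (auto simp: covered_by_def carrier_M)
  ultimately have "covered_by M u v \<longleftrightarrow> (\<exists>x y. u = f x \<and> v = f y \<and> covered_by L x y)" for u v
    by blast
  then show ?thesis by (force simp: cover_pairs_def)
qed

lemma nullity_M: "nullity M = nullity L"
proof -
  have "inj_on (map_prod f f) (cover_pairs L)"
    by (rule inj_on_subset[OF map_prod_inj_on[OF f_inj f_inj]])
      (auto simp: cover_pairs_def covered_by_def)
  then have "card (cover_pairs M) = card (cover_pairs L)"
    by (simp add: cover_pairs_M card_image)
  then show ?thesis
    using nullity_finite_lattice[OF lat fin nonempty] nullity_finite_lattice[OF lattice_M]
      fin nonempty card_carrier by (simp add: carrier_M)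
qed

end

end

section \<open>Counting isomorphism classes\<close>

text \<open>Both images are projections of the set of pairs \<open>(f x, g x)\<close>, and equality
  of the kernels makes both projections injective there.\<close>

lemma card_image_eq_if_kernel_eq:
  assumes "\<And>x y. x \<in> K \<Longrightarrow> y \<in> K \<Longrightarrow> f x = f y \<longleftrightarrow> g x = g y"
  shows "card (f ` K) = card (g ` K)"
proof -
  let ?P = "(\<lambda>x. (f x, g x)) ` K"
  have "inj_on fst ?P" "inj_on snd ?P" using assms by (auto simp: inj_on_def)
  then have "card (fst ` ?P) = card (snd ` ?P)" by (simp only: card_image)
  then show ?thesis by (simp add: image_image)
qed

text \<open>The class is taken among all structures on natural numbers rather than inside some
  \<open>K\<close>, so that types arising from different sets \<open>K\<close> can be
  compared.\<close>

definition iso_type :: "nat gorder \<Rightarrow> nat gorder set" where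
  "iso_type L = {M. order_isomorphic L M}"

lemma iso_type_eq_iff: "iso_type L = iso_type M \<longleftrightarrow> order_isomorphic L M"
  unfolding iso_type_def
  using order_isomorphic_refl order_isomorphic_sym order_isomorphic_trans by blast

text \<open>Restricted and unrestricted classes separate members of \<open>K\<close> in the same
  way, namely up to isomorphism.\<close>

lemma card_iso_classes: "card (iso_classes K) = card (iso_type ` K)"
proof -
  let ?c = "\<lambda>L. {M \<in> K. order_isomorphic L M}"
  have "iso_classes K = ?c ` K"
    by (auto simp: iso_classes_def quotient_def)
  moreover have "card (?c ` K) = card (iso_type ` K)"
  proof (rule card_image_eq_if_kernel_eq)
    fix L M assume "L \<in> K" "M \<in> K"
    then show "?c L = ?c M \<longleftrightarrow> iso_type L = iso_type M"
      unfolding iso_type_eq_iff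
      using order_isomorphic_refl order_isomorphic_sym order_isomorphic_trans by blast
  qed
  ultimately show ?thesis by simp
qed

text \<open>Each structure is transported to the carrier \<open>{..<n}\<close>, on which there are
  finitely many relations.\<close>

lemma finite_iso_types:
  assumes "\<And>L. L \<in> K \<Longrightarrow> finite (carrier L) \<and> card (carrier L) = n"
  shows "finite (iso_type ` K)"
proof -
  define S :: "(nat \<times> nat) set \<Rightarrow> nat gorder"
    where "S r = \<lparr>carrier = {..<n}, eq = (=), le = (\<lambda>x y. (x, y) \<in> r)\<rparr>" for r
  have "iso_type L \<in> (iso_type \<circ> S) ` Pow ({..<n} \<times> {..<n})" if "L \<in> K" for L
  proof -
    have "finite (carrier L)" "card (carrier L) = card {..<n}" using assms[OF that] by auto
    then obtain f where f: "bij_betw f (carrier L) {..<n}"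
      using finite_same_card_bij finite_lessThan by blast
    define r where "r = {(f x, f y) | x y. x \<in> carrier L \<and> y \<in> carrier L \<and> x \<sqsubseteq>\<^bsub>L\<^esub> y}"
    have "order_iso_map f L (S r)"
      using f unfolding order_iso_map_def S_def r_def
      by (auto simp: bij_betw_def dest: inj_onD)
    then have "iso_type L = iso_type (S r)"
      unfolding iso_type_eq_iff order_isomorphic_iff by blast
    moreover have "r \<subseteq> {..<n} \<times> {..<n}" using bij_betwE[OF f] by (auto simp: r_def)
    ultimately show ?thesis by auto
  qed
  then have "iso_type ` K \<subseteq> (iso_type \<circ> S) ` Pow ({..<n} \<times> {..<n})" by blast
  then show ?thesis
    by (rule finite_subset) (intro finite_imageI iffD2[OF finite_Pow_iff] finite_cartesian_product finite_lessThan)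
qed

text \<open>\<open>h\<close> induces a bijection of isomorphism types: it is well defined and
  injective by the second assumption, and surjective by the third.\<close>

lemma card_iso_types_eq:
  assumes "\<And>L. L \<in> K \<Longrightarrow> h L \<in> K'"
    and "\<And>L M. L \<in> K \<Longrightarrow> M \<in> K \<Longrightarrow> order_isomorphic L M \<longleftrightarrow> order_isomorphic (h L) (h M)"
    and "\<And>N. N \<in> K' \<Longrightarrow> \<exists>L\<in>K. order_isomorphic (h L) N"
  shows "card (iso_type ` K) = card (iso_type ` K')"
proof -
  have "(iso_type \<circ> h) ` K = iso_type ` K'"
  proof
    show "(iso_type \<circ> h) ` K \<subseteq> iso_type ` K'" using assms(1) by auto
    show "iso_type ` K' \<subseteq> (iso_type \<circ> h) ` K"
    proof
      fix X assume "X \<in> iso_type ` K'"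
      then obtain N where N: "N \<in> K'" "X = iso_type N" by blast
      then obtain L where "L \<in> K" "order_isomorphic (h L) N" using assms(3) by blast
      then show "X \<in> (iso_type \<circ> h) ` K" using N iso_type_eq_iff[of "h L" N] by auto
    qed
  qed
  moreover have "card (iso_type ` K) = card ((iso_type \<circ> h) ` K)"
    by (rule card_image_eq_if_kernel_eq) (simp add: iso_type_eq_iff assms(2))
  ultimately show ?thesis by simp
qed

section \<open>Removing irreducible least and greatest elements\<close>

definition delete_bottom :: "'a gorder \<Rightarrow> 'a gorder" where
  "delete_bottom L = L\<lparr>carrier := carrier L - {\<bottom>\<^bsub>L\<^esub>}\<rparr>"

text \<open>The successor shift frees \<open>0\<close> for the new least element, and
  \<open>x - 1\<close> undoes the shift. The conjunct \<open>y \<noteq> 0\<close> ensures that only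
  \<open>0\<close> lies below \<open>0\<close>.\<close>

definition add_bottom :: "nat gorder \<Rightarrow> nat gorder" where
  "add_bottom N = \<lparr>carrier = insert 0 (Suc ` carrier N), eq = (=),
     le = (\<lambda>x y. x = 0 \<or> y \<noteq> 0 \<and> x - 1 \<sqsubseteq>\<^bsub>N\<^esub> y - 1)\<rparr>"

text \<open>The reducible element \<open>x\<close> differs from the irreducible least element, so
  something remains after the deletion.\<close>

lemma bottom_extension_delete_bottom:
  assumes L: "lattice L" and fin: "finite (carrier L)"
    and red: "reducible L x" and irr: "\<not> reducible L \<bottom>\<^bsub>L\<^esub>"
  shows "bottom_extension L (delete_bottom L) \<bottom>\<^bsub>L\<^esub>"
proof -
  interpret lattice L by (rule L)
  have x: "x \<in> carrier L" "x \<noteq> \<bottom>\<^bsub>L\<^esub>" using red irr reducible_closed by auto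
  then have "carrier L \<noteq> {}" by blast
  note b = finite_lattice_bottom[OF L fin this]
  show ?thesis
  proof
    show "y = \<bottom>\<^bsub>L\<^esub>" if "y \<in> carrier L" "y \<sqsubseteq>\<^bsub>L\<^esub> \<bottom>\<^bsub>L\<^esub>" for y
      using that b le_antisym by blast
    show "carrier (delete_bottom L) \<noteq> {}" using x by (auto simp: delete_bottom_def)
  qed (use b fin eq_is_equal in \<open>auto simp: delete_bottom_def\<close>)
qed

lemma order_isomorphic_delete_bottom_iff:
  fixes L M :: "'a gorder"
  assumes L: "lattice L" "finite (carrier L)" "carrier L \<noteq> {}"
    and M: "lattice M" "finite (carrier M)" "carrier M \<noteq> {}"
  shows "order_isomorphic (delete_bottom L) (delete_bottom M) \<longleftrightarrow> order_isomorphic L M"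
proof
  interpret L: lattice L by (rule L)
  interpret M: lattice M by (rule M)
  note bL = finite_lattice_bottom[OF L] and bM = finite_lattice_bottom[OF M]
  {
    assume "order_isomorphic L M"
    then obtain f where f: "order_iso_map f L M" by (auto simp: order_isomorphic_iff)
    then interpret lattice_iso L M f by (intro lattice_iso.intro L(1) M.eq_is_equal)
    have "bij_betw f (carrier L - {\<bottom>\<^bsub>L\<^esub>}) (carrier M - {\<bottom>\<^bsub>M\<^esub>})"
      using inj_on_image_set_diff[OF f_inj, of "carrier L" "{\<bottom>\<^bsub>L\<^esub>}"] inj_on_subset[OF f_inj] bL(1)
      by (simp add: bij_betw_def carrier_M bottom_M[OF L(2,3)])
    then have "order_iso_map f (delete_bottom L) (delete_bottom M)"
      using f by (simp add: order_iso_map_def delete_bottom_def)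
    then show "order_isomorphic (delete_bottom L) (delete_bottom M)"
      by (auto simp: order_isomorphic_iff)
  }
  {
    assume "order_isomorphic (delete_bottom L) (delete_bottom M)"
    then obtain f where f: "bij_betw f (carrier L - {\<bottom>\<^bsub>L\<^esub>}) (carrier M - {\<bottom>\<^bsub>M\<^esub>})"
      and f_le: "\<And>x y. x \<in> carrier L \<Longrightarrow> x \<noteq> \<bottom>\<^bsub>L\<^esub> \<Longrightarrow> y \<in> carrier L \<Longrightarrow> y \<noteq> \<bottom>\<^bsub>L\<^esub> \<Longrightarrow>
        x \<sqsubseteq>\<^bsub>L\<^esub> y \<longleftrightarrow> f x \<sqsubseteq>\<^bsub>M\<^esub> f y"
      by (auto simp: order_isomorphic_def delete_bottom_def)
    \<comment> \<open>For the converse, an isomorphism of the remainders is extended by sending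
      least element to least element.\<close>
    define g where "g = f(\<bottom>\<^bsub>L\<^esub> := \<bottom>\<^bsub>M\<^esub>)"
    have g_f: "g x = f x" if "x \<noteq> \<bottom>\<^bsub>L\<^esub>" for x using that by (simp add: g_def)
    have g_bot: "g \<bottom>\<^bsub>L\<^esub> = \<bottom>\<^bsub>M\<^esub>" by (simp add: g_def)
    have "bij_betw g (carrier L - {\<bottom>\<^bsub>L\<^esub>}) (carrier M - {\<bottom>\<^bsub>M\<^esub>})"
      by (rule iffD1[OF bij_betw_cong f]) (simp add: g_f)
    then have "bij_betw g (insert \<bottom>\<^bsub>L\<^esub> (carrier L - {\<bottom>\<^bsub>L\<^esub>})) (insert \<bottom>\<^bsub>M\<^esub> (carrier M - {\<bottom>\<^bsub>M\<^esub>}))"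
      using notIn_Un_bij_betw[of "\<bottom>\<^bsub>L\<^esub>" "carrier L - {\<bottom>\<^bsub>L\<^esub>}" g "carrier M - {\<bottom>\<^bsub>M\<^esub>}"] g_bot by simp
    then have bij: "bij_betw g (carrier L) (carrier M)"
      by (simp add: insert_absorb bL(1) bM(1))
    have fM: "f x \<in> carrier M" "f x \<noteq> \<bottom>\<^bsub>M\<^esub>" if "x \<in> carrier L" "x \<noteq> \<bottom>\<^bsub>L\<^esub>" for x
      using bij_betwE[OF f] that by auto
    have "x \<sqsubseteq>\<^bsub>L\<^esub> y \<longleftrightarrow> g x \<sqsubseteq>\<^bsub>M\<^esub> g y" if xy: "x \<in> carrier L" "y \<in> carrier L" for x y
    proof (cases "x = \<bottom>\<^bsub>L\<^esub>")
      case True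
      then show ?thesis using bL(2) bM(2) xy g_bot bij_betwE[OF bij] by simp
    next
      case x: False
      show ?thesis
      proof (cases "y = \<bottom>\<^bsub>L\<^esub>")
        case True
        have "\<not> x \<sqsubseteq>\<^bsub>L\<^esub> \<bottom>\<^bsub>L\<^esub>" using L.le_antisym bL xy x by blast
        moreover have "\<not> f x \<sqsubseteq>\<^bsub>M\<^esub> \<bottom>\<^bsub>M\<^esub>" using M.le_antisym bM fM[OF xy(1) x] by blast
        ultimately show ?thesis using True x by (simp add: g_f g_bot)
      next
        case False
        then show ?thesis using f_le xy x by (simp add: g_f)
      qed
    qed
    then show "order_isomorphic L M" using bij by (auto simp: order_isomorphic_def)
  }
qed

text \<open>The recursion on the number of elements is needed both with and without the requirement that
  the greatest element is reducible; the flag \<open>t\<close> switches this requirement on.\<close>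

definition top_condition :: "bool \<Rightarrow> 'a gorder \<Rightarrow> bool" where
  "top_condition t L \<longleftrightarrow> (t \<longrightarrow> reducible L \<top>\<^bsub>L\<^esub>)"

section \<open>Recursion on the number of elements\<close>

context
  fixes r k :: nat
  assumes r_pos: "r > 0"
begin

lemma ex_reducible: "L \<in> RC_lattices n r k \<Longrightarrow> \<exists>x. reducible L x"
proof (rule ccontr)
  assume L: "L \<in> RC_lattices n r k" and "\<nexists>x. reducible L x"
  then have "{x. reducible L x} = {}" by blast
  moreover have "card {x. reducible L x} = r" using L by (simp add: RC_lattices_def)
  ultimately show False using r_pos by (metis card.empty less_irrefl)
qed

lemma RC_latticesD:
  assumes "L \<in> RC_lattices n r k"
  shows "lattice L" "finite (carrier L)" "carrier L \<noteq> {}"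
proof -
  obtain x where "reducible L x" using ex_reducible[OF assms] by blast
  then show "carrier L \<noteq> {}" using reducible_closed[of L x] by blast
qed (use assms in \<open>simp_all add: RC_lattices_def RC_lattice_def\<close>)

lemma delete_bottom_RC_lattices:
  assumes L: "L \<in> RC_lattices (Suc n) r k" and irr: "\<not> reducible L \<bottom>\<^bsub>L\<^esub>"
  shows "delete_bottom L \<in> RC_lattices n r k"
    and "top_condition t (delete_bottom L) \<longleftrightarrow> top_condition t L"
proof -
  obtain x where "reducible L x" using ex_reducible[OF L] by blast
  then interpret bottom_extension L "delete_bottom L" "\<bottom>\<^bsub>L\<^esub>"
    by (rule bottom_extension_delete_bottom[OF RC_latticesD(1,2)[OF L] _ irr])
  have lat: "lattice (delete_bottom L)"
    using lattice_M RC_latticesD(1)[OF L] irr by (auto simp: reducible_def)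
  show "delete_bottom L \<in> RC_lattices n r k"
    using L card_L nullity_L[OF lat] RC_lattice_iff[OF lat] fin_M reducible_eq[OF lat]
    by (simp add: RC_lattices_def)
  show "top_condition t (delete_bottom L) \<longleftrightarrow> top_condition t L"
    using reducible_iff[OF lat] top_M[OF lat] by (simp add: top_condition_def)
qed

lemma add_bottom_RC_lattices:
  assumes N: "N \<in> RC_lattices n r k"
  shows "add_bottom N \<in> RC_lattices (Suc n) r k"
    and "\<not> reducible (add_bottom N) \<bottom>\<^bsub>add_bottom N\<^esub>"
    and "top_condition t (add_bottom N) \<longleftrightarrow> top_condition t N"
    and "order_isomorphic (delete_bottom (add_bottom N)) N"
proof -
  \<comment> \<open>\<open>M\<close> is the shifted copy of \<open>N\<close> inside
    \<open>add_bottom N\<close>. The properties pass from \<open>N\<close> to \<open>M\<close> by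
    isomorphism and from \<open>M\<close> to \<open>add_bottom N\<close> by adjoining
    \<open>0\<close>.\<close>
  define M where "M = (add_bottom N)\<lparr>carrier := carrier (add_bottom N) - {0}\<rparr>"
  have M: "carrier M = Suc ` carrier N" by (auto simp: M_def add_bottom_def)
  have iso: "order_iso_map Suc N M"
    unfolding order_iso_map_def M by (simp add: bij_betw_def M_def add_bottom_def)
  have "(.=\<^bsub>M\<^esub>) = (=)" by (simp add: M_def add_bottom_def)
  then interpret N: lattice_iso N M Suc
    by (intro lattice_iso.intro RC_latticesD(1)[OF N] iso)
  note lat = N.lattice_M
  interpret bottom_extension "add_bottom N" M 0
    by unfold_locales (use RC_latticesD[OF N] M in \<open>auto simp: M_def add_bottom_def\<close>)
  note NM = N.nullity_M[OF RC_latticesD(2,3)[OF N]] N.top_M[OF RC_latticesD(2,3)[OF N]]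
  show "add_bottom N \<in> RC_lattices (Suc n) r k"
    using N card_L nullity_L[OF lat] RC_lattice_iff[OF lat] reducible_eq[OF lat]
      N.RC_lattice_M N.card_reducible N.card_carrier NM fin
    by (simp add: RC_lattices_def)
  show "\<not> reducible (add_bottom N) \<bottom>\<^bsub>add_bottom N\<^esub>"
    by (simp add: bottom_L[OF lat] b_irreducible[OF lat])
  show "top_condition t (add_bottom N) \<longleftrightarrow> top_condition t N"
    using N.reducible_f_iff[OF finite_lattice_top(1)[OF RC_latticesD[OF N]]]
    unfolding top_condition_def reducible_eq[OF lat] top_M[OF lat, symmetric] NM(2) by simp
  have "delete_bottom (add_bottom N) = M"
    by (simp add: delete_bottom_def M_def bottom_L[OF lat])
  then show "order_isomorphic (delete_bottom (add_bottom N)) N"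
    using iso order_isomorphic_sym order_isomorphic_iff by metis
qed

text \<open>Deletion of the least element is a bijection of isomorphism types, inverted up to
  isomorphism by \<open>add_bottom\<close>.\<close>

lemma card_irreducible_bottom:
  "card (iso_type ` {L \<in> RC_lattices (Suc n) r k. top_condition t L \<and> \<not> reducible L \<bottom>\<^bsub>L\<^esub>}) =
   card (iso_type ` {L \<in> RC_lattices n r k. top_condition t L})"
  (is "card (iso_type ` ?K) = card (iso_type ` ?K')")
proof (rule card_iso_types_eq[where h = delete_bottom])
  show "delete_bottom L \<in> ?K'" if "L \<in> ?K" for L
    using that delete_bottom_RC_lattices[of L n] by simp
  show "order_isomorphic L M \<longleftrightarrow> order_isomorphic (delete_bottom L) (delete_bottom M)"
    if "L \<in> ?K" "M \<in> ?K" for L M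
  proof -
    have "L \<in> RC_lattices (Suc n) r k" "M \<in> RC_lattices (Suc n) r k" using that by auto
    from order_isomorphic_delete_bottom_iff[OF RC_latticesD[OF this(1)] RC_latticesD[OF this(2)]]
    show ?thesis by simp
  qed
  show "\<exists>L\<in>?K. order_isomorphic (delete_bottom L) N" if "N \<in> ?K'" for N
    by (rule bexI[of _ "add_bottom N"]) (use that add_bottom_RC_lattices[of N n] in simp_all)
qed

lemma reducible_bottom_iso:
  assumes "L \<in> RC_lattices n r k" "M \<in> RC_lattices n r k" "order_isomorphic L M"
  shows "reducible L \<bottom>\<^bsub>L\<^esub> \<longleftrightarrow> reducible M \<bottom>\<^bsub>M\<^esub>"
proof -
  interpret M: lattice M by (rule RC_latticesD(1)[OF assms(2)])
  obtain f where "order_iso_map f L M" using assms(3) by (auto simp: order_isomorphic_iff)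
  then interpret lattice_iso L M f
    by (intro lattice_iso.intro RC_latticesD(1)[OF assms(1)] M.eq_is_equal)
  show ?thesis
    using bottom_M reducible_f_iff finite_lattice_bottom(1) RC_latticesD[OF assms(1)] by metis
qed

text \<open>Reducibility of the least element is invariant under isomorphism, so the types split
  into two disjoint finite sets. Deletion counts the irreducible part on one element fewer.\<close>

lemma card_split_bottom:
  "card (iso_type ` {L \<in> RC_lattices (Suc n) r k. top_condition t L}) =
   card (iso_type ` {L \<in> RC_lattices (Suc n) r k. top_condition t L \<and> reducible L \<bottom>\<^bsub>L\<^esub>}) +
   card (iso_type ` {L \<in> RC_lattices n r k. top_condition t L})"
proof -
  let ?K = "{L \<in> RC_lattices (Suc n) r k. top_condition t L}"
  let ?R = "{L \<in> ?K. reducible L \<bottom>\<^bsub>L\<^esub>}" and ?I = "{L \<in> ?K. \<not> reducible L \<bottom>\<^bsub>L\<^esub>}"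
  have "iso_type ` ?R \<inter> iso_type ` ?I = {}"
    using reducible_bottom_iso iso_type_eq_iff by (smt (verit) disjoint_iff imageE mem_Collect_eq)
  moreover have "finite (iso_type ` ?R)" "finite (iso_type ` ?I)"
    by (rule finite_iso_types[where n = "Suc n"], simp add: RC_lattices_def)+
  moreover have "iso_type ` ?K = iso_type ` ?R \<union> iso_type ` ?I" by blast
  ultimately have "card (iso_type ` ?K) = card (iso_type ` ?R) + card (iso_type ` ?I)"
    by (simp only: card_Un_disjoint)
  then show ?thesis using card_irreducible_bottom[of n t] by (simp add: conj_assoc)
qed

section \<open>Duality and the two summations\<close>

lemma dual_RC_lattices:
  assumes L: "L \<in> RC_lattices n r k"
  shows "inv_gorder L \<in> RC_lattices n r k"
proof -
  have lat: "lattice L" by (rule RC_latticesD(1)[OF L])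
  have "cover_edges (inv_gorder L) = cover_edges L"
    unfolding cover_edges_def covered_by_dual[OF lat] by (metis insert_commute)
  then have "nullity (inv_gorder L) = nullity L"
    by (simp add: nullity_def cover_components_def cover_connected_def)
  moreover have "RC_lattice (inv_gorder L)"
    using L lattice_dual[OF lat] by (auto simp: RC_lattices_def RC_lattice_def reducible_dual)
  ultimately show ?thesis using L by (simp add: RC_lattices_def reducible_dual)
qed

lemma card_reducible_bottom_eq_reducible_top:
  "card (iso_type ` {L \<in> RC_lattices n r k. reducible L \<bottom>\<^bsub>L\<^esub>}) =
   card (iso_type ` {L \<in> RC_lattices n r k. reducible L \<top>\<^bsub>L\<^esub>})"
proof (rule card_iso_types_eq[where h = inv_gorder])
  show "\<exists>L\<in>{L \<in> RC_lattices n r k. reducible L \<bottom>\<^bsub>L\<^esub>}. order_isomorphic (inv_gorder L) N"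
    if "N \<in> {L \<in> RC_lattices n r k. reducible L \<top>\<^bsub>L\<^esub>}" for N
  proof (rule bexI[of _ "inv_gorder N"])
    show "order_isomorphic (inv_gorder (inv_gorder N)) N"
      unfolding inv_gorder_inv by (rule order_isomorphic_refl)
  qed (use that dual_RC_lattices[of N n] in \<open>simp_all add: reducible_dual\<close>)
qed (simp_all add: dual_RC_lattices order_isomorphic_dual reducible_dual)

lemma RC_lattices_0: "RC_lattices 0 r k = {}"
proof (rule ccontr)
  assume "RC_lattices 0 r k \<noteq> {}"
  then obtain L where L: "L \<in> RC_lattices 0 r k" by blast
  then have "card (carrier L) = 0" by (simp add: RC_lattices_def)
  then show False using RC_latticesD(2,3)[OF L] by simp
qed

text \<open>First summation: when the greatest element is reducible, the lattices with reducible
  least element that enter at size \<open>Suc n\<close> are exactly the blocks of that size.\<close>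

lemma card_reducible_top:
  "card (iso_type ` {L \<in> RC_lattices n r k. reducible L \<top>\<^bsub>L\<^esub>}) = (\<Sum>j\<le>n. card (\<B> j r k))"
proof (induction n)
  case 0
  then show ?case by (simp add: RC_lattices_0 \<B>_def RC_blocks_def card_iso_classes)
next
  case (Suc n)
  have "RC_blocks (Suc n) r k = {L \<in> RC_lattices (Suc n) r k. reducible L \<top>\<^bsub>L\<^esub> \<and> reducible L \<bottom>\<^bsub>L\<^esub>}"
    by (auto simp: RC_blocks_def block_def RC_lattices_def RC_lattice_def)
  then show ?case
    using card_split_bottom[of n True] Suc by (simp add: top_condition_def \<B>_def card_iso_classes)
qed

text \<open>Second summation: the part that enters at each size has a reducible least element. By
  duality it is as numerous as the lattices with reducible greatest element, already known as a
  partial sum over blocks.\<close>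

lemma card_RC_lattices_eq_sum_blocks:
  "card (\<L> n r k) = (\<Sum>j\<le>n. (n - j + 1) * card (\<B> j r k))"
proof (induction n)
  case 0
  then show ?case by (simp add: RC_lattices_0 \<L>_def \<B>_def RC_blocks_def card_iso_classes)
next
  case (Suc n)
  have "card (\<L> (Suc n) r k) = (\<Sum>j\<le>Suc n. card (\<B> j r k)) + card (\<L> n r k)"
    using card_split_bottom[of n False] card_reducible_bottom_eq_reducible_top[of "Suc n"]
      card_reducible_top[of "Suc n"]
    by (simp add: top_condition_def \<L>_def card_iso_classes)
  \<comment> \<open>Adding the partial sum raises every old weight by one, and blocks of size
    \<open>Suc n\<close> enter with weight one.\<close>
  also have "\<dots> = (\<Sum>j\<le>n. (Suc n - j + 1) * card (\<B> j r k)) + card (\<B> (Suc n) r k)"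
    by (simp add: Suc sum.distrib[symmetric] Suc_diff_le)
  finally show ?case by simp
qed

end

section \<open>Blocks are not too small\<close>

lemma irreducible_upper_cover_unique:
  assumes lat: "lattice L" and irr: "\<not> reducible L x" and cov: "covered_by L x y" "covered_by L x y'"
  shows "y = y'"
proof (rule ccontr)
  assume ne: "y \<noteq> y'"
  interpret lattice L by (rule lat)
  note c = cov[unfolded covered_by_iff[OF lat]]
  have "greatest L x (Lower L {y, y'})"
  proof -
    have yy': "y \<in> carrier L" "y' \<in> carrier L" using c by auto
    have "u \<sqsubseteq>\<^bsub>L\<^esub> x" if u: "u \<in> carrier L" "u \<sqsubseteq>\<^bsub>L\<^esub> y" "u \<sqsubseteq>\<^bsub>L\<^esub> y'" for u
    proof -
      have x: "x \<in> carrier L" using c by blast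
      have j: "x \<squnion>\<^bsub>L\<^esub> u \<in> carrier L" "x \<sqsubseteq>\<^bsub>L\<^esub> x \<squnion>\<^bsub>L\<^esub> u" "u \<sqsubseteq>\<^bsub>L\<^esub> x \<squnion>\<^bsub>L\<^esub> u"
        using x u by (auto intro: join_left join_right)
      have "x \<squnion>\<^bsub>L\<^esub> u \<sqsubseteq>\<^bsub>L\<^esub> y" "x \<squnion>\<^bsub>L\<^esub> u \<sqsubseteq>\<^bsub>L\<^esub> y'"
        using c u x yy' by (auto intro!: join_le)
      \<comment> \<open>This join lies between \<open>x\<close> and each of the two covers, so it
        belongs to both \<open>{x, y}\<close> and \<open>{x, y'}\<close>, which share only
        \<open>x\<close>.\<close>
      then have "x \<squnion>\<^bsub>L\<^esub> u = x" using c j ne by metis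
      then show ?thesis using j by simp
    qed
    then show ?thesis unfolding greatest_Lower_pair_iff[OF yy'] using c by blast
  qed
  then have "meet_reducible L x" using meet_reducibleI[OF lat, of y y' x] c by blast
  then show False using irr by (simp add: reducible_def)
qed

lemma irreducible_lower_cover_unique:
  assumes "lattice L" "\<not> reducible L x" "covered_by L y x" "covered_by L y' x"
  shows "y = y'"
  using irreducible_upper_cover_unique[OF lattice_dual[OF assms(1)], of x y y'] assms
  by (simp add: reducible_dual covered_by_dual)

text \<open>A cover has two reducible ends, an irreducible lower end, or an irreducible upper end;
  overlap of the last two kinds is harmless for an upper bound. There are at most
  \<open>card R - 1\<close>, \<open>card I\<close> and \<open>card I\<close> covers of these
  kinds.\<close>

lemma card_cover_pairs_le:
  assumes RC: "RC_lattice L" and fin: "finite (carrier L)" and ne: "{x. reducible L x} \<noteq> {}"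
  shows "card (cover_pairs L) + card {x. reducible L x} + 1 \<le> 2 * card (carrier L)"
proof -
  have lat: "lattice L" using RC by (simp add: RC_lattice_def)
  interpret lattice L by (rule lat)
  define R where "R = {x. reducible L x}"
  define I where "I = carrier L - R"
  define A where "A = {p \<in> cover_pairs L. fst p \<in> R \<and> snd p \<in> R}"
  define U where "U = {p \<in> cover_pairs L. fst p \<in> I}"
  define D where "D = {p \<in> cover_pairs L. snd p \<in> I}"
  have R_sub: "R \<subseteq> carrier L" using reducible_closed by (auto simp: R_def)
  have finR: "finite R" using finite_subset[OF R_sub fin] .
  have finC: "finite (cover_pairs L)" by (rule finite_cover_pairs[OF fin])
  have chain: "x \<sqsubseteq>\<^bsub>L\<^esub> y \<or> y \<sqsubseteq>\<^bsub>L\<^esub> x" if "x \<in> R" "y \<in> R" for x y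
    using RC that by (simp add: RC_lattice_def R_def)
  have cov: "covered_by L (fst p) (snd p)" if "p \<in> cover_pairs L" for p
    using that by (auto simp: cover_pairs_def)
  have "card U \<le> card I"
  proof (rule card_inj_on_le[where f = fst])
    show "inj_on fst U"
      using irreducible_upper_cover_unique[OF lat] cov by (auto simp: inj_on_def U_def I_def R_def)
  qed (auto simp: U_def I_def fin)
  moreover have "card D \<le> card I"
  proof (rule card_inj_on_le[where f = snd])
    show "inj_on snd D"
      using irreducible_lower_cover_unique[OF lat] cov by (auto simp: inj_on_def D_def I_def R_def)
  qed (auto simp: D_def I_def fin)
  moreover have "card A + 1 \<le> card R"
  proof -
    obtain m where m: "m \<in> R" "\<And>x. x \<in> R \<Longrightarrow> x \<sqsubseteq>\<^bsub>L\<^esub> m"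
    proof -
      \<comment> \<open>The claim is made for all nonempty finite subsets of \<open>R\<close>, to
        allow induction; the greatest element \<open>m\<close> of the chain \<open>R\<close>
        results.\<close>
      have "\<exists>m\<in>S. \<forall>x\<in>S. x \<sqsubseteq>\<^bsub>L\<^esub> m" if "finite S" "S \<noteq> {}" "S \<subseteq> R" for S
        using that
      proof (induction S rule: finite_ne_induct)
        case (singleton x)
        then show ?case using R_sub by auto
      next
        case (insert x F)
        then obtain m where m: "m \<in> F" "\<forall>y\<in>F. y \<sqsubseteq>\<^bsub>L\<^esub> m" by auto
        have c: "x \<in> carrier L" "m \<in> carrier L" "F \<subseteq> carrier L" using insert.prems m R_sub by auto
        consider "x \<sqsubseteq>\<^bsub>L\<^esub> m" | "m \<sqsubseteq>\<^bsub>L\<^esub> x" using chain insert.prems m by blast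
        then show ?case
        proof cases
          case 1
          then show ?thesis using m by blast
        next
          case 2
          then have "\<forall>y\<in>insert x F. y \<sqsubseteq>\<^bsub>L\<^esub> x"
            using m c le_trans[of _ m x] by blast
          then show ?thesis by blast
        qed
      qed
      then show ?thesis using that finR ne by (metis R_def subset_refl)
    qed
    \<comment> \<open>Reducible upper covers of the same element are comparable, hence equal, so a
      cover in \<open>A\<close> is determined by its lower end. The greatest reducible element
      \<open>m\<close> is never such a lower end, which gains the one.\<close>
    have "card A \<le> card (R - {m})"
    proof (rule card_inj_on_le[where f = fst])
      show "inj_on fst A"
      proof (rule inj_onI)
        fix p q assume pq: "p \<in> A" "q \<in> A" "fst p = fst q"
        have cp: "covered_by L (fst p) (snd p)" "covered_by L (fst p) (snd q)"
          using cov[of p] cov[of q] pq by (simp_all add: A_def)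
        have "snd p \<sqsubseteq>\<^bsub>L\<^esub> snd q \<or> snd q \<sqsubseteq>\<^bsub>L\<^esub> snd p" using chain pq by (auto simp: A_def)
        then have "snd p = snd q"
          using cp[unfolded covered_by_iff[OF lat]] by metis
        then show "p = q" using pq(3) by (simp add: prod_eq_iff)
      qed
      have "fst p \<noteq> m" if p: "p \<in> A" for p
      proof
        assume "fst p = m"
        then have "covered_by L m (snd p)" "snd p \<in> R" using p cov by (auto simp: A_def)
        then show False using m(2)[of "snd p"] le_antisym unfolding covered_by_iff[OF lat] by blast
      qed
      then show "fst ` A \<subseteq> R - {m}" by (auto simp: A_def)
    qed (simp add: finR)
    then show ?thesis using card_Suc_Diff1[OF finR m(1)] by simp
  qed
  moreover have "card (cover_pairs L) \<le> card A + card U + card D"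
  proof -
    have "cover_pairs L \<subseteq> A \<union> U \<union> D"
      by (auto simp: A_def U_def D_def I_def cover_pairs_def covered_by_def)
    then have "card (cover_pairs L) \<le> card (A \<union> U \<union> D)"
      by (rule card_mono[rotated]) (simp add: A_def U_def D_def finC)
    also have "\<dots> \<le> card A + card U + card D"
      using card_Un_le[of "A \<union> U" D] card_Un_le[of A U] by linarith
    finally show ?thesis .
  qed
  moreover have "card I + card R = card (carrier L)"
    using card_Diff_subset[OF finR R_sub] card_mono[OF fin R_sub] by (simp add: I_def)
  ultimately show ?thesis unfolding R_def by linarith
qed

text \<open>Nullity \<open>k\<close> means \<open>n + k - 1\<close> covers, and the bound on covers
  then gives \<open>r + k \<le> n\<close>. For \<open>r = 5\<close> and \<open>k = 3\<close> this is
  the threshold 8.\<close>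

lemma RC_lattices_empty:
  assumes "r > 0" "n < r + k"
  shows "RC_lattices n r k = {}"
proof (rule ccontr)
  assume "RC_lattices n r k \<noteq> {}"
  then obtain L where L: "L \<in> RC_lattices n r k" by blast
  note D = RC_latticesD[OF assms(1) L]
  have card: "card {x. reducible L x} = r" "card (carrier L) = n" "nullity L = int k" "RC_lattice L"
    using L by (auto simp: RC_lattices_def)
  then have "int (card (cover_pairs L)) = int k + int n - 1"
    using nullity_finite_lattice[OF D] by simp
  moreover have "card (cover_pairs L) + r + 1 \<le> 2 * n"
    using card_cover_pairs_le[OF card(4) D(2)] card assms(1) by fastforce
  ultimately show False using assms(2) by linarith
qed

theorem theorem2p38:
  fixes n :: nat
  assumes "n \<ge> 8"
  shows "card (\<L> n 5 3) = (\<Sum>i = 0..n - 8. (i + 1) * card (\<B> (n - i) 5 3))"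
proof -
  have zero: "card (\<B> j 5 3) = 0" if "j < 8" for j
    using RC_lattices_empty[of 5 j 3] that by (simp add: \<B>_def RC_blocks_def card_iso_classes)
  have "card (\<L> n 5 3) = (\<Sum>j\<le>n. (n - j + 1) * card (\<B> j 5 3))"
    by (rule card_RC_lattices_eq_sum_blocks) simp
  \<comment> \<open>The sizes below 8 contribute nothing, by \<open>zero\<close>.\<close>
  also have "\<dots> = (\<Sum>j\<in>{8..n}. (n - j + 1) * card (\<B> j 5 3))"
    by (rule sum.mono_neutral_right) (auto simp: zero)
  \<comment> \<open>Substitution of \<open>i = n - j\<close>, the number of elements outside the
    block; the range of \<open>j\<close> from 8 to \<open>n\<close> becomes that of \<open>i\<close>
    from 0 to \<open>n - 8\<close>.\<close>
  also have "\<dots> = (\<Sum>i = 0..n - 8. (i + 1) * card (\<B> (n - i) 5 3))"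
    by (rule sum.reindex_bij_witness[where i = "\<lambda>i. n - i" and j = "\<lambda>j. n - j"]) (use assms in auto)
  finally show ?thesis .
qed

end
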